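(* Let $n=2l$ be even, $c\in\mathbb{R}$, let $N(c)$ be an oriented $(n+1)$-dimensional Riemannian manifold of constant sectional curvature $c$, and let $M\hookrightarrow N(c)$ be an oriented hypersurface with principal curvatures $\lambda_1,\dots,\lambda_n$. Let $\Omega=[\Omega_{ij}]_{i,j=1,\dots,n}$ be the skew-symmetric matrix of curvature $2$-forms of $M$ in a positively oriented orthonormal frame $e_1,\dots,e_n$ of principal directions, that is, $\Omega_{ij}=(c+\lambda_i\lambda_j)\,e^i\wedge e^j$. Then $$\mathrm{Pf}(\Omega)=\mathrm{P}\,\mathrm{vol}_M,\qquad \mathrm{P}=\sum_{p=0}^{l}(2l-2p-1)!!\,(2p-1)!!\,c^{\,l-p}\,S_{2p}(\lambda_1,\dots,\lambda_n).$$
   Context: A hypersurface is a closed orientable $C^2$ embedded submanifold of codimension one. The principal curvatures are the eigenvalues of $A=\nabla_{\cdot}\vec n$ on $TM$, with $\vec n$ a unit normal field, and $Ae_i=\lambda_ie_i$. $e^1,\dots,e^n$ is the coframe dual to $e_1,\dots,e_n$, and $\mathrm{vol}_M=e^1\wedge\cdots\wedge e^n$. $S_i$ is the $i$-th elementary symmetric polynomial, $S_0=1$; $(2p-1)!!=(2p-1)(2p-3)\cdots3\cdot1$, $(-1)!!=1$. $\mathrm{Pf}$ is the Pfaffian polynomial of a skew-symmetric matrix, evaluated in the commutative algebra of even-degree forms (products being wedge products), normalized so that $\mathrm{Pf}\begin{pmatrix}0&a\\-a&0\end{pmatrix}=a$ and, for an $n\times n$ skew-symmetric matrix $X=[x_{ij}]$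 with $n\geq 4$ even, $\mathrm{Pf}(X)=\sum_{j=2}^n(-1)^jx_{1j}\,\mathrm{Pf}(X^{1j})$, where $X^{1j}$ is $X$ with the rows and columns of index $1$ and $j$ removed. *)

theory Defs
  imports "HOL-Analysis.Analysis"
begin

section \<open>Oriented Riemannian manifolds\<close>

text \<open>
  The ambient manifold is the whole type \<open>'p\<close>; its charts take values in
  \<^typ>\<open>real^'m\<close>, so its dimension is \<open>CARD('m)\<close>. Tangent vectors and tensors at a point are
  handled through their coordinate representatives in each chart, together with the
  transformation law under changes of charts.
\<close>

type_synonym ('p, 'm) chart = "'p set \<times> ('p \<Rightarrow> real^'m)"

abbreviation cdom :: "('p, 'm) chart \<Rightarrow> 'p set" where "cdom C \<equiv> fst C"
abbreviation cmap :: "('p, 'm) chart \<Rightarrow> 'p \<Rightarrow> real^'m" where "cmap C \<equiv> snd C"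

text \<open>For open \<open>S\<close> this is the usual class $C^k$, by continuity of iterated directional derivatives.\<close>

primrec Ck_on :: "nat \<Rightarrow> 'a::euclidean_space set \<Rightarrow> ('a \<Rightarrow> 'b::real_normed_vector) \<Rightarrow> bool" where
  "Ck_on 0 S f \<longleftrightarrow> continuous_on S f"
| "Ck_on (Suc k) S f \<longleftrightarrow>
     (\<forall>x\<in>S. f differentiable (at x)) \<and> (\<forall>v. Ck_on k S (\<lambda>x. frechet_derivative f (at x) v))"

definition smooth_on :: "'a::euclidean_space set \<Rightarrow> ('a \<Rightarrow> 'b::real_normed_vector) \<Rightarrow> bool" where
  "smooth_on S f \<longleftrightarrow> (\<forall>k. Ck_on k S f)"

definition is_chart :: "('p::topological_space, 'm::finite) chart \<Rightarrow> bool" where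
  "is_chart C \<longleftrightarrow> open (cdom C) \<and> open (cmap C ` cdom C) \<and>
     homeomorphism (cdom C) (cmap C ` cdom C) (cmap C) (inv_into (cdom C) (cmap C))"

definition overlap :: "('p, 'm) chart \<Rightarrow> ('p, 'm) chart \<Rightarrow> (real^'m) set" where
  "overlap C C' = cmap C ` (cdom C \<inter> cdom C')"

definition transition :: "('p, 'm) chart \<Rightarrow> ('p, 'm) chart \<Rightarrow> real^'m \<Rightarrow> real^'m" where
  "transition C C' x = cmap C' (inv_into (cdom C) (cmap C) x)"

definition dtransition ::
  "('p, 'm::finite) chart \<Rightarrow> ('p, 'm) chart \<Rightarrow> real^'m \<Rightarrow> real^'m \<Rightarrow> real^'m" where
  "dtransition C C' x = frechet_derivative (transition C C') (at x)"

definition oriented_smooth_atlas :: "('p::topological_space, 'm::finite) chart set \<Rightarrow> bool" where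
  "oriented_smooth_atlas \<A> \<longleftrightarrow>
     (\<forall>C\<in>\<A>. is_chart C) \<and> (\<Union>C\<in>\<A>. cdom C) = UNIV \<and>
     (\<forall>C\<in>\<A>. \<forall>C'\<in>\<A>. smooth_on (overlap C C') (transition C C') \<and>
        (\<forall>x\<in>overlap C C'. det (matrix (dtransition C C' x)) > 0))"

text \<open>
  \<open>g C x\<close> is the inner product of the tangent space at the point with coordinates \<open>x\<close>, in the
  chart \<open>C\<close>.
\<close>

type_synonym ('p, 'm) metric = "('p, 'm) chart \<Rightarrow> real^'m \<Rightarrow> real^'m \<Rightarrow> real^'m \<Rightarrow> real"

definition riemannian_metric ::
  "('p::topological_space, 'm::finite) chart set \<Rightarrow> ('p, 'm) metric \<Rightarrow> bool" where
  "riemannian_metric \<A> g \<longleftrightarrow>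
     (\<forall>C\<in>\<A>. (\<forall>x \<in> cmap C ` cdom C. bilinear (g C x) \<and> (\<forall>v w. g C x v w = g C x w v) \<and>
                  (\<forall>v. v \<noteq> 0 \<longrightarrow> g C x v v > 0)) \<and>
        (\<forall>v w. smooth_on (cmap C ` cdom C) (\<lambda>x. g C x v w))) \<and>
     (\<forall>C\<in>\<A>. \<forall>C'\<in>\<A>. \<forall>x\<in>overlap C C'. \<forall>v w.
        g C x v w = g C' (transition C C' x) (dtransition C C' x v) (dtransition C C' x w))"

text \<open>
  In the next three definitions \<open>h\<close> is the metric in a fixed chart. \<open>christoffel h x X Y\<close> is the
  vector $\Gamma_x(X,Y) = \nabla_X Y$ for the constant coordinate fields \<open>X\<close>, \<open>Y\<close>, given by the
  Koszul formula, and \<open>riemann h x X Y Z\<close> is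
  $R(X,Y)Z = \nabla_X\nabla_Y Z - \nabla_Y\nabla_X Z$ for constant coordinate fields.
\<close>

definition christoffel ::
  "(real^'m::finite \<Rightarrow> real^'m \<Rightarrow> real^'m \<Rightarrow> real) \<Rightarrow> real^'m \<Rightarrow> real^'m \<Rightarrow> real^'m \<Rightarrow> real^'m" where
  "christoffel h x X Y = (THE Z. \<forall>W. 2 * h x Z W =
       frechet_derivative (\<lambda>y. h y Y W) (at x) X
     + frechet_derivative (\<lambda>y. h y X W) (at x) Y
     - frechet_derivative (\<lambda>y. h y X Y) (at x) W)"

definition riemann ::
  "(real^'m::finite \<Rightarrow> real^'m \<Rightarrow> real^'m \<Rightarrow> real) \<Rightarrow>
     real^'m \<Rightarrow> real^'m \<Rightarrow> real^'m \<Rightarrow> real^'m \<Rightarrow> real^'m" where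
  "riemann h x X Y Z =
       frechet_derivative (\<lambda>y. christoffel h y Y Z) (at x) X
     - frechet_derivative (\<lambda>y. christoffel h y X Z) (at x) Y
     + christoffel h x X (christoffel h x Y Z) - christoffel h x Y (christoffel h x X Z)"

definition sectional_curvature ::
  "(real^'m::finite \<Rightarrow> real^'m \<Rightarrow> real^'m \<Rightarrow> real) \<Rightarrow> real^'m \<Rightarrow> real^'m \<Rightarrow> real^'m \<Rightarrow> real" where
  "sectional_curvature h x X Y =
     h x (riemann h x X Y Y) X / (h x X X * h x Y Y - (h x X Y)\<^sup>2)"

definition constant_sectional_curvature ::
  "('p, 'm::finite) chart set \<Rightarrow> ('p, 'm) metric \<Rightarrow> real \<Rightarrow> bool" where
  "constant_sectional_curvature \<A> g c \<longleftrightarrow>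
     (\<forall>C\<in>\<A>. \<forall>x \<in> cmap C ` cdom C. \<forall>X Y. X \<noteq> Y \<and> independent {X, Y} \<longrightarrow>
        sectional_curvature (g C) x X Y = c)"

text \<open>
  An orientation of \<^typ>\<open>real^'m\<close> needs an order of the coordinates, which the index type
  \<open>'m\<close> does not carry. It is given by a bijection \<open>b\<close> from \<open>'m\<close> to \<open>{0..n}\<close>: the basis of
  coordinate vectors enumerated through \<open>b\<close> is positive. The charts of an oriented atlas then
  transport this orientation to the manifold.
\<close>

definition positive_basis :: "('m::finite \<Rightarrow> nat) \<Rightarrow> (nat \<Rightarrow> real^'m) \<Rightarrow> bool" where
  "positive_basis b w \<longleftrightarrow> det (\<chi> i j. w (b j) $ i) > 0"

section \<open>Hypersurfaces\<close>

definition local_image :: "'p set \<Rightarrow> ('p, 'm) chart \<Rightarrow> (real^'m) set" where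
  "local_image M C = cmap C ` (M \<inter> cdom C)"

text \<open>
  The submanifold condition is the existence of $C^2$ slice charts. Only closedness as a subset is
  required, so that compact hypersurfaces and properly embedded ones are both covered.
\<close>

definition hypersurface :: "('p::topological_space, 'm::finite) chart set \<Rightarrow> 'p set \<Rightarrow> bool" where
  "hypersurface \<A> M \<longleftrightarrow> closed M \<and>
     (\<forall>C\<in>\<A>. \<forall>x \<in> local_image M C. \<exists>W (\<psi> :: real^'m \<Rightarrow> real^'m) k.
        open W \<and> x \<in> W \<and> W \<subseteq> cmap C ` cdom C \<and> inj_on \<psi> W \<and> open (\<psi> ` W) \<and>
        Ck_on 2 W \<psi> \<and> Ck_on 2 (\<psi> ` W) (inv_into W \<psi>) \<and>
        \<psi> ` (W \<inter> local_image M C) = \<psi> ` W \<inter> {y. y $ k = 0})"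

text \<open>Tangent vectors of \<open>S\<close> at \<open>x\<close> are the velocities of curves in \<open>S\<close>.\<close>

definition tangent_space :: "(real^'m::finite) set \<Rightarrow> real^'m \<Rightarrow> (real^'m) set" where
  "tangent_space S x =
     {v. \<exists>\<gamma> :: real \<Rightarrow> real^'m. \<gamma> 0 = x \<and> (\<forall>t. \<gamma> t \<in> S) \<and> (\<gamma> has_vector_derivative v) (at 0)}"

text \<open>
  \<open>\<nu> C x\<close> is the coordinate representative, in the chart \<open>C\<close>, of the normal at the point of \<open>M\<close>
  with coordinates \<open>x\<close>.
\<close>

definition unit_normal_field ::
  "('p::topological_space, 'm::finite) chart set \<Rightarrow> ('p, 'm) metric \<Rightarrow> 'p set \<Rightarrow>
     (('p, 'm) chart \<Rightarrow> real^'m \<Rightarrow> real^'m) \<Rightarrow> bool" where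
  "unit_normal_field \<A> g M \<nu> \<longleftrightarrow>
     (\<forall>C\<in>\<A>. continuous_on (local_image M C) (\<nu> C) \<and>
        (\<forall>x \<in> local_image M C. g C x (\<nu> C x) (\<nu> C x) = 1 \<and>
           (\<forall>v \<in> tangent_space (local_image M C) x. g C x (\<nu> C x) v = 0))) \<and>
     (\<forall>C\<in>\<A>. \<forall>C'\<in>\<A>. \<forall>x \<in> local_image M C \<inter> overlap C C'.
        \<nu> C' (transition C C' x) = dtransition C C' x (\<nu> C x))"

text \<open>
  $A X = \nabla_X \vec n$ for \<open>X\<close> tangent to the hypersurface. The derivative of \<open>\<nu>\<close> within \<open>S\<close>
  is determined only on tangent vectors of \<open>S\<close>, and only there is this definition meaningful.
\<close>

definition shape_operator ::
  "(real^'m::finite \<Rightarrow> real^'m \<Rightarrow> real^'m \<Rightarrow> real) \<Rightarrow> (real^'m) set \<Rightarrow> (real^'m \<Rightarrow> real^'m) \<Rightarrow>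
     real^'m \<Rightarrow> real^'m \<Rightarrow> real^'m" where
  "shape_operator h S \<nu> x X =
     frechet_derivative \<nu> (at x within S) X + christoffel h x X (\<nu> x)"

text \<open>
  A positively oriented orthonormal basis \<open>e 1, \<dots>, e n\<close> of the tangent space of \<open>M\<close>, at the point
  with coordinates \<open>x\<close> in the chart \<open>C\<close>, made of principal directions, with principal curvatures
  \<open>\<kappa> 1, \<dots>, \<kappa> n\<close>. The hypersurface is oriented by its normal: \<open>e\<close> is positive if
  \<open>\<nu>, e 1, \<dots>, e n\<close> is positive in the ambient manifold.
\<close>

definition principal_frame ::
  "('m::finite \<Rightarrow> nat) \<Rightarrow> ('p, 'm) metric \<Rightarrow> 'p set \<Rightarrow> (('p, 'm) chart \<Rightarrow> real^'m \<Rightarrow> real^'m) \<Rightarrow>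
     ('p, 'm) chart \<Rightarrow> real^'m \<Rightarrow> nat \<Rightarrow> (nat \<Rightarrow> real^'m) \<Rightarrow> (nat \<Rightarrow> real) \<Rightarrow> bool" where
  "principal_frame b g M \<nu> C x n e \<kappa> \<longleftrightarrow>
     span (e ` {1..n}) = tangent_space (local_image M C) x \<and>
     (\<forall>i\<in>{1..n}. \<forall>j\<in>{1..n}. g C x (e i) (e j) = (if i = j then 1 else 0)) \<and>
     positive_basis b (e(0 := \<nu> C x)) \<and>
     (\<forall>i\<in>{1..n}. shape_operator (g C) (local_image M C) (\<nu> C) x (e i) = \<kappa> i *\<^sub>R e i)"

section \<open>Alternating forms and the Pfaffian\<close>

text \<open>
  A \<open>k\<close>-form is an alternating multilinear function of \<open>v 1, \<dots>, v k\<close>, represented as a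
  function of the whole sequence \<open>v\<close>. The normalization of the wedge product is the one for which
  $(e^1 \wedge \cdots \wedge e^k)(e_1,\dots,e_k) = 1$.
\<close>

type_synonym 'v form = "(nat \<Rightarrow> 'v) \<Rightarrow> real"

definition wedge :: "nat \<Rightarrow> nat \<Rightarrow> 'v form \<Rightarrow> 'v form \<Rightarrow> 'v form" where
  "wedge k m \<alpha> \<beta> = (\<lambda>v. (\<Sum>\<sigma> | \<sigma> permutes {1..k + m}.
       of_int (sign \<sigma>) * \<alpha> (\<lambda>i. v (\<sigma> i)) * \<beta> (\<lambda>i. v (\<sigma> (k + i)))) / (fact k * fact m))"

definition one_form :: "('v \<Rightarrow> real) \<Rightarrow> 'v form" where
  "one_form \<epsilon> = (\<lambda>v. \<epsilon> (v 1))"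

definition coframe :: "nat \<Rightarrow> (nat \<Rightarrow> 'v::real_vector) \<Rightarrow> nat \<Rightarrow> 'v form" where
  "coframe n e i = one_form (\<lambda>v. representation (e ` {1..n}) v (e i))"

primrec wedge_upto :: "nat \<Rightarrow> (nat \<Rightarrow> 'v form) \<Rightarrow> 'v form" where
  "wedge_upto 0 \<epsilon> = (\<lambda>v. 1)"
| "wedge_upto (Suc k) \<epsilon> = wedge k 1 (wedge_upto k \<epsilon>) (\<epsilon> (Suc k))"

definition vol_form :: "nat \<Rightarrow> (nat \<Rightarrow> 'v::real_vector) \<Rightarrow> 'v form" where
  "vol_form n e = wedge_upto n (coframe n e)"

text \<open>The curvature forms of the hypersurface, as given by the Gauss equation.\<close>

definition curvature_form ::
  "nat \<Rightarrow> real \<Rightarrow> (nat \<Rightarrow> real) \<Rightarrow> (nat \<Rightarrow> 'v::real_vector) \<Rightarrow> nat \<Rightarrow> nat \<Rightarrow> 'v form" where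
  "curvature_form n c \<kappa> e i j =
     (\<lambda>v. (c + \<kappa> i * \<kappa> j) * wedge 1 1 (coframe n e i) (coframe n e j) v)"

text \<open>Matrices have indices in \<open>{1..n}\<close>; here rows and columns \<open>1\<close> and \<open>j\<close> are removed.\<close>

definition remove_1 :: "nat \<Rightarrow> (nat \<Rightarrow> nat \<Rightarrow> 'a) \<Rightarrow> nat \<Rightarrow> nat \<Rightarrow> 'a" where
  "remove_1 j X = (let s = (\<lambda>a. if a + 1 < j then a + 1 else a + 2) in (\<lambda>a b. X (s a) (s b)))"

text \<open>
  The Pfaffian of an \<open>n \<times> n\<close> matrix of 2-forms, an \<open>n\<close>-form. The empty matrix has Pfaffian 1;
  the value for odd \<open>n\<close> is irrelevant.
\<close>

fun Pf :: "nat \<Rightarrow> (nat \<Rightarrow> nat \<Rightarrow> 'v form) \<Rightarrow> 'v form" where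
  "Pf n X =
     (if n = 0 then (\<lambda>v. 1)
      else if odd n then (\<lambda>v. 0)
      else if n = 2 then X 1 2
      else (\<lambda>v. \<Sum>j = 2..n. (-1) ^ j * wedge 2 (n - 2) (X 1 j) (Pf (n - 2) (remove_1 j X)) v))"

declare Pf.simps [simp del]

section \<open>The polynomial\<close>

definition elem_sym :: "nat \<Rightarrow> nat \<Rightarrow> (nat \<Rightarrow> real) \<Rightarrow> real" where
  "elem_sym n i \<kappa> = (\<Sum>A | A \<subseteq> {1..n} \<and> card A = i. \<Prod>a\<in>A. \<kappa> a)"

text \<open>\<open>odd_dfact p\<close> is $(2p-1)!!$, with $(-1)!! = 1$.\<close>

definition odd_dfact :: "nat \<Rightarrow> nat" where
  "odd_dfact p = (\<Prod>k = 1..p. 2 * k - 1)"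

definition curvature_poly :: "nat \<Rightarrow> real \<Rightarrow> (nat \<Rightarrow> real) \<Rightarrow> real" where
  "curvature_poly l c \<kappa> =
     (\<Sum>p = 0..l. real (odd_dfact (l - p)) * real (odd_dfact p) * c ^ (l - p) *
        elem_sym (2 * l) (2 * p) \<kappa>)"

end

theory Submission
  imports Defs
begin

text \<open>
  At a point, the identity is purely algebraic in the one-forms $e^1,\dots,e^n$. Expanding the
  Pfaffian along the first row, moving $e^j$ next to $e^1$ in the volume form costs the sign
  $(-1)^j$, which cancels the sign of the expansion; hence \<open>Pf \<Omega> = P \<sqdot> vol\<close>, where \<open>P\<close> obeys the
  signless recursion $P(\lambda) = \sum_{j \geq 2} (c + \lambda_1\lambda_j)\, P(\lambda^{1j})$.
  The stated polynomial satisfies this recursion because of the identities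
  $\sum_j S_k(\mu^j) = (N - k) S_k(\mu)$ and $\sum_j \mu_j S_k(\mu^j) = (k + 1) S_{k+1}(\mu)$ for
  the elementary symmetric polynomials in \<open>N\<close> variables.
\<close>

section \<open>Wedge products of one-forms\<close>

text \<open>The determinant of the matrix \<open>f i (v j)\<close>, that is, for finite
  \<open>A\<close> the wedge product of the \<open>f i\<close> in increasing order. An arbitrary
  index set lets the two factors of a product occupy disjoint blocks of positions.\<close>

definition det_form :: "nat set \<Rightarrow> (nat \<Rightarrow> 'v \<Rightarrow> real) \<Rightarrow> 'v form" where
  "det_form A f v = (\<Sum>\<sigma> | \<sigma> permutes A. of_int (sign \<sigma>) * (\<Prod>i\<in>A. f i (v (\<sigma> i))))"

lemma det_form_cong: "(\<And>i. i \<in> A \<Longrightarrow> f i = g i) \<Longrightarrow> det_form A f = det_form A g"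
  by (simp add: det_form_def fun_eq_iff)

lemma one_form_eq_det_form: "one_form \<phi> = det_form {1..1} (\<lambda>_. \<phi>)"
  by (rule ext) (simp add: one_form_def det_form_def)

text \<open>Antisymmetry in the factors: composing \<open>\<sigma>\<close> with \<open>\<pi>\<close>
  on the right changes each sign by \<open>sign \<pi>\<close> and only reorders the product.\<close>

lemma det_form_permute:
  assumes "finite A" and \<pi>: "\<pi> permutes A"
  shows "det_form A (\<lambda>i. f (\<pi> i)) v = of_int (sign \<pi>) * det_form A f v"
proof -
  have perm: "permutation \<sigma>" if "\<sigma> permutes A" for \<sigma>
    using that \<open>finite A\<close> permutation_permutes by blast
  have "det_form A (\<lambda>i. f (\<pi> i)) v =
      (\<Sum>\<sigma> | \<sigma> permutes A. of_int (sign (\<sigma> \<circ> \<pi>)) * (\<Prod>i\<in>A. f (\<pi> i) (v (\<sigma> (\<pi> i)))))"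
    unfolding det_form_def by (subst sum_permutations_compose_right[OF \<pi>]) simp
  also have "\<dots> = (\<Sum>\<sigma> | \<sigma> permutes A. of_int (sign \<pi>) *
      (of_int (sign \<sigma>) * (\<Prod>i\<in>A. f i (v (\<sigma> i)))))"
  proof (intro sum.cong refl)
    fix \<sigma> assume "\<sigma> \<in> {\<sigma>. \<sigma> permutes A}"
    moreover have "(\<Prod>i\<in>A. f (\<pi> i) (v (\<sigma> (\<pi> i)))) = (\<Prod>i\<in>A. f i (v (\<sigma> i)))"
      by (rule prod.reindex_bij_betw[OF permutes_imp_bij[OF \<pi>]])
    ultimately show "of_int (sign (\<sigma> \<circ> \<pi>)) * (\<Prod>i\<in>A. f (\<pi> i) (v (\<sigma> (\<pi> i)))) =
        of_int (sign \<pi>) * (of_int (sign \<sigma>) * (\<Prod>i\<in>A. f i (v (\<sigma> i))))"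
      by (simp add: sign_compose perm \<pi>)
  qed
  finally show ?thesis by (simp add: det_form_def sum_distrib_left)
qed

text \<open>Conjugation by \<open>s\<close> carries the permutations of \<open>A\<close> to those of
  its image and preserves signs. This serves to shift the index block of the second factor of a
  wedge product.\<close>

lemma det_form_image:
  assumes "finite A" and s: "inj_on s A"
  shows "det_form A (\<lambda>i. f (s i)) (\<lambda>i. v (s i)) = det_form (s ` A) f v"
proof -
  have bij: "bij_betw s A (s ` A)"
    using s by (simp add: bij_betw_def)
  have inv: "inv_into A s (s a) = a" if "a \<in> A" for a
    using s that by simp
  have "det_form (s ` A) f v = (\<Sum>\<sigma> | \<sigma> permutes A. of_int (sign (map_permutation A s \<sigma>)) *
      (\<Prod>i\<in>s ` A. f i (v (map_permutation A s \<sigma> i))))"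
    unfolding det_form_def
  proof (rule sum.reindex_bij_witness[where j = "map_permutation (s ` A) (inv_into A s)"
        and i = "map_permutation A s"], goal_cases)
    case (1 \<sigma>)
    then show ?case
      using map_permutation_compose_inv[of "inv_into A s" "s ` A" A \<sigma> s] bij
      by (auto simp: bij_betw_inv_into f_inv_into_f)
  next
    case (2 \<sigma>)
    then show ?case
      using map_permutation_permutes[OF bij_betw_inv_into[OF bij]] by auto
  next
    case (3 \<sigma>)
    then show ?case
      using map_permutation_compose_inv[OF bij, of \<sigma> "inv_into A s"] inv by auto
  next
    case (4 \<sigma>)
    then show ?case using map_permutation_permutes[OF bij] by auto
  next
    case (5 \<sigma>)
    then show ?case
      using map_permutation_compose_inv[of "inv_into A s" "s ` A" A \<sigma> s] bij
      by (auto simp: bij_betw_inv_into f_inv_into_f)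
  qed
  also have "\<dots> = det_form A (\<lambda>i. f (s i)) (\<lambda>i. v (s i))"
    unfolding det_form_def
    by (intro sum.cong refl)
      (use s \<open>finite A\<close> in \<open>auto simp: sign_map_permutation prod.reindex map_permutation_apply\<close>)
  finally show ?thesis by simp
qed

text \<open>
  Expanding both factors gives a triple sum over $\sigma$, $\tau$, $\rho$; the substitution
  $\sigma \mapsto \sigma \circ (\tau\rho)^{-1}$ makes all $|A|!\,|B|!$ inner sums equal.
\<close>

lemma sum_det_form_mult_det_form:
  assumes fin: "finite A" "finite B" and disj: "A \<inter> B = {}"
  shows "(\<Sum>\<sigma> | \<sigma> permutes A \<union> B. of_int (sign \<sigma>) * det_form A f (\<lambda>i. v (\<sigma> i)) *
      det_form B f (\<lambda>i. v (\<sigma> i))) = fact (card A) * fact (card B) * det_form (A \<union> B) f v"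
proof -
  have inner: "(\<Sum>\<sigma> | \<sigma> permutes A \<union> B. of_int (sign \<sigma>) *
      (of_int (sign \<tau>) * (\<Prod>i\<in>A. f i (v (\<sigma> (\<tau> i))))) *
      (of_int (sign \<rho>) * (\<Prod>i\<in>B. f i (v (\<sigma> (\<rho> i)))))) = det_form (A \<union> B) f v"
    if \<tau>: "\<tau> permutes A" and \<rho>: "\<rho> permutes B" for \<tau> \<rho>
  proof -
    have \<tau>': "\<tau> permutes A \<union> B" and \<rho>': "\<rho> permutes A \<union> B"
      using permutes_subset[OF \<tau>] permutes_subset[OF \<rho>] by auto
    have perm: "permutation \<sigma>" if "\<sigma> permutes A \<union> B" for \<sigma>
      using that fin permutation_permutes finite_UnI by blast
    \<comment> \<open>The blocks are disjoint, so \<open>\<rho> \<circ> \<tau>\<close> acts as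
      \<open>\<tau>\<close> on \<open>A\<close> and as \<open>\<rho>\<close> on \<open>B\<close>,
      and the product over the union splits.\<close>
    have A: "\<rho> (\<tau> i) = \<tau> i" "\<tau> i \<in> A" if "i \<in> A" for i
      using that disj permutes_in_image[OF \<tau>] permutes_not_in[OF \<rho>] by auto
    have B: "\<rho> (\<tau> i) = \<rho> i" if "i \<in> B" for i
      by (subst permutes_not_in[OF \<tau>]) (use that disj in auto)
    have "det_form (A \<union> B) f v = (\<Sum>\<sigma> | \<sigma> permutes A \<union> B. of_int (sign (\<sigma> \<circ> (\<rho> \<circ> \<tau>))) *
        (\<Prod>i\<in>A \<union> B. f i (v ((\<sigma> \<circ> (\<rho> \<circ> \<tau>)) i))))"
      unfolding det_form_def
      by (rule sum_permutations_compose_right[OF permutes_compose[OF \<tau>' \<rho>']])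
    also have "\<dots> = (\<Sum>\<sigma> | \<sigma> permutes A \<union> B. of_int (sign \<sigma>) *
        (of_int (sign \<tau>) * (\<Prod>i\<in>A. f i (v (\<sigma> (\<tau> i))))) *
        (of_int (sign \<rho>) * (\<Prod>i\<in>B. f i (v (\<sigma> (\<rho> i))))))"
    proof (intro sum.cong refl)
      fix \<sigma> assume "\<sigma> \<in> {\<sigma>. \<sigma> permutes A \<union> B}"
      moreover have "(\<Prod>i\<in>A \<union> B. f i (v ((\<sigma> \<circ> (\<rho> \<circ> \<tau>)) i))) =
          (\<Prod>i\<in>A. f i (v (\<sigma> (\<tau> i)))) * (\<Prod>i\<in>B. f i (v (\<sigma> (\<rho> i))))"
        by (simp add: prod.union_disjoint fin disj A B)
      ultimately show "of_int (sign (\<sigma> \<circ> (\<rho> \<circ> \<tau>))) * (\<Prod>i\<in>A \<union> B. f i (v ((\<sigma> \<circ> (\<rho> \<circ> \<tau>)) i))) =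
          of_int (sign \<sigma>) * (of_int (sign \<tau>) * (\<Prod>i\<in>A. f i (v (\<sigma> (\<tau> i))))) *
          (of_int (sign \<rho>) * (\<Prod>i\<in>B. f i (v (\<sigma> (\<rho> i)))))"
        by (simp add: sign_compose perm permutation_compose \<tau>' \<rho>')
    qed
    finally show ?thesis by simp
  qed
  have "(\<Sum>\<sigma> | \<sigma> permutes A \<union> B. of_int (sign \<sigma>) * det_form A f (\<lambda>i. v (\<sigma> i)) *
      det_form B f (\<lambda>i. v (\<sigma> i))) =
      (\<Sum>\<sigma> | \<sigma> permutes A \<union> B. \<Sum>\<tau> | \<tau> permutes A. \<Sum>\<rho> | \<rho> permutes B. of_int (sign \<sigma>) *
      (of_int (sign \<tau>) * (\<Prod>i\<in>A. f i (v (\<sigma> (\<tau> i))))) *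
      (of_int (sign \<rho>) * (\<Prod>i\<in>B. f i (v (\<sigma> (\<rho> i))))))"
    by (simp only: det_form_def mult.assoc sum_product) (simp only: sum_distrib_left mult.assoc)
  also have "\<dots> = (\<Sum>\<tau> | \<tau> permutes A. \<Sum>\<rho> | \<rho> permutes B. \<Sum>\<sigma> | \<sigma> permutes A \<union> B.
      of_int (sign \<sigma>) * (of_int (sign \<tau>) * (\<Prod>i\<in>A. f i (v (\<sigma> (\<tau> i))))) *
      (of_int (sign \<rho>) * (\<Prod>i\<in>B. f i (v (\<sigma> (\<rho> i))))))"
    by (rule trans[OF sum.swap], rule sum.cong[OF refl], rule sum.swap)
  also have "\<dots> = (\<Sum>\<tau> | \<tau> permutes A. \<Sum>\<rho> | \<rho> permutes B. det_form (A \<union> B) f v)"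
    by (intro sum.cong refl inner) auto
  finally show ?thesis
    by (simp add: card_permutations[OF refl] fin)
qed

text \<open>After a shift by \<open>k\<close> the second factor lives on
  \<open>{k + 1..k + m}\<close>, and the factorials produced by the sum over all permutations cancel
  those in \<open>wedge\<close>.\<close>

lemma wedge_det_form:
  "wedge k m (det_form {1..k} f) (det_form {1..m} g) =
     det_form {1..k + m} (\<lambda>i. if i \<le> k then f i else g (i - k))" (is "_ = det_form _ ?h")
proof
  fix v :: "nat \<Rightarrow> 'a"
  have shift: "det_form {1..m} g (\<lambda>i. v (\<sigma> (k + i))) = det_form {k + 1..k + m} ?h (\<lambda>i. v (\<sigma> i))"
    for \<sigma>
  proof -
    have "det_form {1..m} g (\<lambda>i. v (\<sigma> (k + i))) =
        det_form {1..m} (\<lambda>i. ?h (k + i)) (\<lambda>i. v (\<sigma> (k + i)))"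
      by (rule fun_cong[OF det_form_cong]) auto
    also have "\<dots> = det_form ((+) k ` {1..m}) ?h (\<lambda>i. v (\<sigma> i))"
      by (rule det_form_image[where v = "\<lambda>i. v (\<sigma> i)"]) auto
    finally show ?thesis by (simp add: add.commute)
  qed
  have f: "det_form {1..k} f = det_form {1..k} ?h"
    by (rule det_form_cong) auto
  have "{1..k + m} = {1..k} \<union> {k + 1..k + m}" by auto
  then show "wedge k m (det_form {1..k} f) (det_form {1..m} g) v = det_form {1..k + m} ?h v"
    using sum_det_form_mult_det_form[of "{1..k}" "{k + 1..k + m}" ?h v]
    by (simp only: wedge_def shift f) simp
qed

lemma wedge_upto_one_form:
  "wedge_upto k (\<lambda>i. one_form (f i)) = det_form {1..k} f"
proof (induction k)
  case 0
  show ?case by (rule ext) (simp add: det_form_def)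
next
  case (Suc k)
  then have "wedge_upto (Suc k) (\<lambda>i. one_form (f i)) =
      det_form {1..k + 1} (\<lambda>i. if i \<le> k then f i else f (Suc k))"
    by (simp only: wedge_upto.simps one_form_eq_det_form[of "f (Suc k)"] wedge_det_form)
  also have "\<dots> = det_form {1..Suc k} f"
    by (simp, rule det_form_cong) (auto simp: le_Suc_eq)
  finally show ?case .
qed

lemma wedge_one_form_one_form:
  "wedge 1 1 (one_form \<phi>) (one_form \<psi>) = det_form {1..2} (\<lambda>i. if i = 1 then \<phi> else \<psi>)"
  unfolding one_form_eq_det_form wedge_det_form
  by (simp add: numeral_2_eq_2, rule det_form_cong) auto

lemma wedge_scale:
  "wedge k m (\<lambda>v. a * \<alpha> v) (\<lambda>v. b * \<beta> v) v = a * b * wedge k m \<alpha> \<beta> v"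
  by (simp add: wedge_def sum_distrib_left mult_ac)

section \<open>The permutation moving an index to the second place\<close>

text \<open>The sequence \<open>1, j, 2, \<dots>, j - 1, j + 1, \<dots>\<close>.\<close>

definition to_second :: "nat \<Rightarrow> nat \<Rightarrow> nat" where
  "to_second j i = (if i = 2 then j else if 3 \<le> i \<and> i \<le> j then i - 1 else i)"

text \<open>Raising \<open>j\<close> by one composes with the transposition of \<open>j\<close> and
  \<open>Suc j\<close>, which flips the sign; at \<open>j = 2\<close> the map is the identity. The
  bound by \<open>n\<close> sits in the goal because the induction raises \<open>j\<close> with
  \<open>n\<close> fixed.\<close>

lemma to_second_permutes_sign:
  assumes "2 \<le> j"
  shows "j \<le> n \<Longrightarrow> to_second j permutes {1..n} \<and> sign (to_second j) = (-1) ^ j"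
  using assms
proof (induction j rule: nat_induct_at_least)
  case base
  have "to_second 2 = id" by (auto simp: to_second_def fun_eq_iff)
  then show ?case by (simp only: permutes_id sign_id) simp
next
  case (Suc j)
  have eq: "to_second (Suc j) = Transposition.transpose j (Suc j) \<circ> to_second j"
    using Suc.hyps by (auto simp: to_second_def fun_eq_iff Transposition.transpose_def)
  have "Transposition.transpose j (Suc j) permutes {1..n}"
    using Suc by (intro permutes_swap_id) auto
  moreover have "permutation (to_second j)"
    using Suc permutation_permutes by (metis Suc_leD finite_atLeastAtMost)
  ultimately show ?case
    unfolding eq using Suc
    by (simp only: sign_compose permutation_swap_id sign_swap_id, intro conjI permutes_compose) simp_all
qed

text \<open>The index map inside \<open>remove_1\<close>: for \<open>2 \<le> j\<close> it lists,
  from \<open>a = 1\<close> on, the indices above 1 other than \<open>j\<close>.\<close>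

definition skip :: "nat \<Rightarrow> nat \<Rightarrow> nat" where
  "skip j a = (if a + 1 < j then a + 1 else a + 2)"

lemma to_second_add_2: "1 \<le> a \<Longrightarrow> to_second j (a + 2) = skip j a"
  by (auto simp: to_second_def skip_def)

lemma inj_skip: "inj (skip j)"
  by (auto simp: inj_on_def skip_def split: if_splits)

lemma skip_image:
  assumes "2 \<le> j" "j \<le> n + 2"
  shows "skip j ` {1..n} = {2..n + 2} - {j}"
proof (intro equalityI subsetI)
  fix i assume i: "i \<in> {2..n + 2} - {j}"
  then have "i = skip j (if i < j then i - 1 else i - 2)"
    by (auto simp: skip_def)
  then show "i \<in> skip j ` {1..n}"
    by (rule image_eqI) (use i assms in auto)
qed (use assms in \<open>auto simp: skip_def split: if_splits\<close>)

section \<open>Elementary symmetric polynomials\<close>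

text \<open>Over an arbitrary index set, so that single variables can be deleted or adjoined without
  renumbering.\<close>

definition esym :: "nat set \<Rightarrow> nat \<Rightarrow> (nat \<Rightarrow> real) \<Rightarrow> real" where
  "esym A k f = (\<Sum>B | B \<subseteq> A \<and> card B = k. \<Prod>b\<in>B. f b)"

lemma elem_sym_eq_esym: "elem_sym n k f = esym {1..n} k f"
  by (simp add: elem_sym_def esym_def)

lemma esym_0: "finite A \<Longrightarrow> esym A 0 f = 1"
proof -
  assume "finite A"
  then have "{B. B \<subseteq> A \<and> card B = 0} = {{}}"
    using finite_subset by fastforce
  then show ?thesis by (simp add: esym_def)
qed

lemma esym_eq_0: "finite A \<Longrightarrow> card A < k \<Longrightarrow> esym A k f = 0"
  unfolding esym_def by (rule sum.neutral) (use card_mono in \<open>auto simp: not_less[symmetric]\<close>)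

text \<open>A subset of size \<open>Suc k\<close> either avoids \<open>a\<close> or arises from a
  subset of \<open>A\<close> of size \<open>k\<close> by adding \<open>a\<close>.\<close>

lemma esym_insert:
  assumes "finite A" "a \<notin> A"
  shows "esym (insert a A) (Suc k) f = esym A (Suc k) f + f a * esym A k f"
proof -
  have eq: "{B. B \<subseteq> insert a A \<and> card B = Suc k} =
      {B. B \<subseteq> A \<and> card B = Suc k} \<union> insert a ` {B. B \<subseteq> A \<and> card B = k}" (is "_ = ?X \<union> ?Y")
  proof (intro equalityI subsetI)
    fix B assume B: "B \<in> {B. B \<subseteq> insert a A \<and> card B = Suc k}"
    show "B \<in> ?X \<union> ?Y"
    proof (cases "a \<in> B")
      case True
      then have "B = insert a (B - {a})" "B - {a} \<subseteq> A" "card (B - {a}) = k"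
        using B by auto
      then show ?thesis by blast
    qed (use B in auto)
  next
    fix B assume "B \<in> ?X \<union> ?Y"
    then show "B \<in> {B. B \<subseteq> insert a A \<and> card B = Suc k}"
      using assms finite_subset[OF _ assms(1)] by (auto simp: card_insert_if)
  qed
  have inj: "inj_on (insert a) {B. B \<subseteq> A \<and> card B = k}"
    using assms by (auto simp: inj_on_def)
  have "esym (insert a A) (Suc k) f = (\<Sum>B\<in>?X. \<Prod>b\<in>B. f b) + (\<Sum>B\<in>?Y. \<Prod>b\<in>B. f b)"
    unfolding esym_def eq using assms by (intro sum.union_disjoint) auto
  also have "(\<Sum>B\<in>?Y. \<Prod>b\<in>B. f b) = (\<Sum>B | B \<subseteq> A \<and> card B = k. f a * (\<Prod>b\<in>B. f b))"
    unfolding sum.reindex[OF inj] o_def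
    by (intro sum.cong refl) (use assms finite_subset in \<open>auto intro!: prod.insert\<close>)
  finally show ?thesis by (simp add: esym_def sum_distrib_left)
qed

lemma esym_remove:
  assumes "finite A" "a \<in> A"
  shows "esym A (Suc k) f = esym (A - {a}) (Suc k) f + f a * esym (A - {a}) k f"
  using esym_insert[of "A - {a}" a k f] assms by (simp add: insert_absorb)

lemma esym_image:
  assumes "inj_on s A"
  shows "esym A k (\<lambda>i. f (s i)) = esym (s ` A) k f"
proof -
  let ?P = "{B. B \<subseteq> A \<and> card B = k}"
  have inj: "inj_on s B" if "B \<in> ?P" for B
    using inj_on_subset[OF assms] that by blast
  have "{B. B \<subseteq> s ` A \<and> card B = k} = (`) s ` ?P"
    using card_image[OF inj_on_subset[OF assms]] by (auto simp: subset_image_iff)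
  moreover have "inj_on ((`) s) ?P"
    by (rule inj_on_subset[OF inj_on_image_Pow[OF assms]]) auto
  moreover have "(\<Prod>b\<in>s ` B. f b) = (\<Prod>b\<in>B. f (s b))" if "B \<in> ?P" for B
    by (simp add: prod.reindex[OF inj[OF that]])
  ultimately show ?thesis
    by (simp add: esym_def sum.reindex del: mem_Collect_eq)
qed

text \<open>Double counting: the monomial of a \<open>k\<close>-subset \<open>B\<close> survives
  exactly for the \<open>card A - k\<close> choices of \<open>j\<close> outside \<open>B\<close>.
  Subtracting in the reals keeps the identity valid for \<open>k > card A\<close>, where both sides
  vanish.\<close>

lemma sum_esym_remove:
  assumes "finite A"
  shows "(\<Sum>j\<in>A. esym (A - {j}) k f) = (real (card A) - real k) * esym A k f"
proof -
  have "(\<Sum>j\<in>A. esym (A - {j}) k f) =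
      (\<Sum>j\<in>A. \<Sum>B | B \<subseteq> A \<and> card B = k. if j \<in> B then 0 else \<Prod>b\<in>B. f b)"
    unfolding esym_def
    by (intro sum.cong refl sum.mono_neutral_cong_left) (use assms in auto)
  also have "\<dots> = (\<Sum>B | B \<subseteq> A \<and> card B = k. \<Sum>j\<in>A. if j \<in> B then 0 else \<Prod>b\<in>B. f b)"
    by (rule sum.swap)
  also have "\<dots> = (\<Sum>B | B \<subseteq> A \<and> card B = k. (real (card A) - real k) * (\<Prod>b\<in>B. f b))"
  proof (intro sum.cong refl)
    fix B assume "B \<in> {B. B \<subseteq> A \<and> card B = k}"
    then have B: "B \<subseteq> A" "card B = k" by auto
    have "(\<Sum>j\<in>A. if j \<in> B then 0 else \<Prod>b\<in>B. f b) = (\<Sum>j\<in>A - B. \<Prod>b\<in>B. f b)"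
      by (intro sum.mono_neutral_cong_right) (use assms in auto)
    also have "\<dots> = (real (card A) - real k) * (\<Prod>b\<in>B. f b)"
      using B assms finite_subset[OF B(1)]
      by (simp add: card_Diff_subset card_mono of_nat_diff flip: B(2))
    finally show "(\<Sum>j\<in>A. if j \<in> B then 0 else \<Prod>b\<in>B. f b) =
        (real (card A) - real k) * (\<Prod>b\<in>B. f b)" .
  qed
  finally show ?thesis by (simp add: esym_def sum_distrib_left)
qed

text \<open>Each summand is \<open>esym A (Suc k) f - esym (A - {j}) (Suc k) f\<close>; summed over
  \<open>j\<close>, these carry the coefficient \<open>card A - (card A - (k + 1))\<close>.\<close>

lemma sum_mult_esym_remove:
  assumes "finite A"
  shows "(\<Sum>j\<in>A. f j * esym (A - {j}) k f) = (real k + 1) * esym A (Suc k) f"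
proof -
  have "(\<Sum>j\<in>A. f j * esym (A - {j}) k f) =
      (\<Sum>j\<in>A. esym A (Suc k) f - esym (A - {j}) (Suc k) f)"
    by (intro sum.cong refl) (simp add: esym_remove[OF assms])
  then show ?thesis
    by (simp add: sum_subtractf sum_esym_remove[OF assms] algebra_simps)
qed

section \<open>The recursion for the curvature polynomial\<close>

lemma odd_dfact_Suc: "odd_dfact (Suc p) = (2 * p + 1) * odd_dfact p"
  by (simp add: odd_dfact_def)

text \<open>\<open>A\<close> holds the \<open>2l + 1\<close> indices left after 1. In the sum over
  \<open>j\<close>, the factor \<open>c\<close> brings \<open>N - 2p = 2(l - p) + 1\<close>, which
  extends the first double factorial, while \<open>\<kappa> 1\<close> brings \<open>2p + 1\<close>,
  which extends the second.\<close>

lemma curvature_poly_esym_recursion: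
  fixes l :: nat
  defines "A \<equiv> {2..2 * l + 2}" and "N \<equiv> real (2 * l + 1)"
    and "d \<equiv> \<lambda>q p. real (odd_dfact q) * real (odd_dfact p)"
  shows "(\<Sum>j\<in>A. (c + \<kappa> 1 * \<kappa> j) *
      (\<Sum>p = 0..l. d (l - p) p * c ^ (l - p) * esym (A - {j}) (2 * p) \<kappa>)) =
      curvature_poly (Suc l) c \<kappa>"
proof -
  have fin: "finite A" and card: "real (card A) = N"
    by (auto simp: A_def N_def)
  have "(\<Sum>j\<in>A. (c + \<kappa> 1 * \<kappa> j) *
      (\<Sum>p = 0..l. d (l - p) p * c ^ (l - p) * esym (A - {j}) (2 * p) \<kappa>)) =
      (\<Sum>p = 0..l. \<Sum>j\<in>A. d (l - p) p * c ^ (l - p) *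
        (c * esym (A - {j}) (2 * p) \<kappa> + \<kappa> 1 * (\<kappa> j * esym (A - {j}) (2 * p) \<kappa>)))"
    by (subst sum.swap) (simp add: sum_distrib_left algebra_simps)
  also have "\<dots> = (\<Sum>p = 0..l. d (l - p) p * c ^ (l - p) *
      (c * ((N - 2 * p) * esym A (2 * p) \<kappa>) + \<kappa> 1 * ((2 * p + 1) * esym A (Suc (2 * p)) \<kappa>)))"
    by (simp add: sum_esym_remove[OF fin] sum_mult_esym_remove[OF fin] card sum.distrib
        flip: sum_distrib_left) (simp add: add.commute)
  also have "\<dots> = (\<Sum>p = 0..l. d (Suc l - p) p * c ^ (Suc l - p) * esym A (2 * p) \<kappa>) +
      (\<Sum>p = 0..l. d (l - p) (Suc p) * c ^ (l - p) * (\<kappa> 1 * esym A (Suc (2 * p)) \<kappa>))"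
    unfolding sum.distrib[symmetric]
  proof (intro sum.cong refl)
    fix p assume "p \<in> {0..l}"
    then obtain q where "l = p + q"
      using le_Suc_ex by auto
    then have "l - p = q" "Suc l - p = Suc q" "N - 2 * p = 2 * real q + 1"
      by (auto simp: N_def)
    then show "d (l - p) p * c ^ (l - p) * (c * ((N - 2 * p) * esym A (2 * p) \<kappa>) +
        \<kappa> 1 * ((2 * p + 1) * esym A (Suc (2 * p)) \<kappa>)) =
        d (Suc l - p) p * c ^ (Suc l - p) * esym A (2 * p) \<kappa> +
        d (l - p) (Suc p) * c ^ (l - p) * (\<kappa> 1 * esym A (Suc (2 * p)) \<kappa>)"
      by (simp add: d_def odd_dfact_Suc algebra_simps)
  qed
  \<comment> \<open>The added term \<open>p = Suc l\<close> is zero: \<open>A\<close> has only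
    \<open>2l + 1\<close> elements, hence no subset of size \<open>2l + 2\<close>.\<close>
  also have "(\<Sum>p = 0..l. d (Suc l - p) p * c ^ (Suc l - p) * esym A (2 * p) \<kappa>) =
      (\<Sum>p = 0..Suc l. d (Suc l - p) p * c ^ (Suc l - p) * esym A (2 * p) \<kappa>)"
    using esym_eq_0[OF fin, of "2 * Suc l" \<kappa>] by (simp add: A_def)
  \<comment> \<open>Splitting off \<open>p = 0\<close> and shifting aligns the two sums, so that
    \<open>esym_insert\<close> can then merge them by adjoining the variable of index 1.\<close>
  also have "\<dots> = d (Suc l) 0 * c ^ Suc l +
      (\<Sum>p = 0..l. d (l - p) (Suc p) * c ^ (l - p) * esym A (Suc (Suc (2 * p))) \<kappa>)"
    by (subst sum.atLeast0_atMost_Suc_shift) (simp add: esym_0 fin)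
  also have "\<dots> + (\<Sum>p = 0..l. d (l - p) (Suc p) * c ^ (l - p) * (\<kappa> 1 * esym A (Suc (2 * p)) \<kappa>)) =
      d (Suc l) 0 * c ^ Suc l +
      (\<Sum>p = 0..l. d (l - p) (Suc p) * c ^ (l - p) * esym (insert 1 A) (2 * Suc p) \<kappa>)"
    using fin by (simp add: esym_insert A_def sum.distrib algebra_simps)
  also have "\<dots> = curvature_poly (Suc l) c \<kappa>"
  proof -
    have "{1..2 * Suc l} = insert 1 A" by (auto simp: A_def)
    then show ?thesis
      unfolding curvature_poly_def elem_sym_eq_esym
      by (subst sum.atLeast0_atMost_Suc_shift) (simp add: esym_0 fin d_def)
  qed
  finally show ?thesis .
qed

text \<open>By \<open>esym_image\<close>, renumbering the variables through \<open>skip j\<close>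
  amounts to working over \<open>{2..2 * l + 2}\<close> without \<open>j\<close>.\<close>

lemma curvature_poly_recursion:
  "(\<Sum>j = 2..2 * l + 2. (c + \<kappa> 1 * \<kappa> j) * curvature_poly l c (\<lambda>i. \<kappa> (skip j i))) =
     curvature_poly (Suc l) c \<kappa>"
proof -
  have "curvature_poly l c (\<lambda>i. \<kappa> (skip j i)) =
      (\<Sum>p = 0..l. real (odd_dfact (l - p)) * real (odd_dfact p) * c ^ (l - p) *
        esym ({2..2 * l + 2} - {j}) (2 * p) \<kappa>)" if "j \<in> {2..2 * l + 2}" for j
    using esym_image[OF inj_on_subset[OF inj_skip[of j] subset_UNIV], of "{1..2 * l}" _ \<kappa>]
      skip_image[of j "2 * l"] that
    by (simp add: curvature_poly_def elem_sym_eq_esym)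
  then show ?thesis
    unfolding curvature_poly_esym_recursion[symmetric] by (intro sum.cong refl) simp
qed

section \<open>The Pfaffian\<close>

text \<open>\<open>coframe n e\<close> depends on the whole frame; arbitrary functions in place of
  the dual coframe make the class closed under \<open>remove_1\<close>, as the induction on the
  Pfaffian requires.\<close>

definition gauss_form ::
  "real \<Rightarrow> (nat \<Rightarrow> real) \<Rightarrow> (nat \<Rightarrow> 'v \<Rightarrow> real) \<Rightarrow> nat \<Rightarrow> nat \<Rightarrow> 'v form" where
  "gauss_form c \<kappa> f i j =
     (\<lambda>v. (c + \<kappa> i * \<kappa> j) * wedge 1 1 (one_form (f i)) (one_form (f j)) v)"

lemma curvature_form_eq_gauss_form:
  "curvature_form n c \<kappa> e = gauss_form c \<kappa> (\<lambda>i v. representation (e ` {1..n}) v (e i))"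
  by (simp add: curvature_form_def gauss_form_def coframe_def fun_eq_iff)

lemma remove_1_gauss_form:
  "remove_1 j (gauss_form c \<kappa> f) = gauss_form c (\<lambda>i. \<kappa> (skip j i)) (\<lambda>i. f (skip j i))"
  by (simp add: remove_1_def gauss_form_def skip_def fun_eq_iff)

text \<open>The left side multiplies the \<open>f i\<close> in the order 1, \<open>j\<close>, then
  the rest increasing, which is the order given by \<open>to_second j\<close>.\<close>

lemma wedge_det_form_to_second:
  assumes j: "2 \<le> j" "j \<le> n + 2"
  shows "wedge 2 n (wedge 1 1 (one_form (f 1)) (one_form (f j)))
      (det_form {1..n} (\<lambda>i. f (skip j i))) v = (-1) ^ j * det_form {1..n + 2} f v"
proof -
  have "wedge 2 n (wedge 1 1 (one_form (f 1)) (one_form (f j)))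
      (det_form {1..n} (\<lambda>i. f (skip j i))) = det_form {1..2 + n} (\<lambda>i. f (to_second j i))"
    unfolding wedge_one_form_one_form wedge_det_form
  proof (rule det_form_cong, goal_cases)
    case (1 i)
    consider "i = 1" | "i = 2" | a where "i = a + 2" "1 \<le> a"
    proof -
      have "i = 1 \<or> i = 2 \<or> (\<exists>a\<ge>1. i = a + 2)"
        using 1 by simp presburger
      then show ?thesis using that by blast
    qed
    then show ?case
      by cases (auto simp: to_second_def simp flip: to_second_add_2)
  qed
  moreover have "det_form {1..n + 2} (\<lambda>i. f (to_second j i)) v = (-1) ^ j * det_form {1..n + 2} f v"
    using to_second_permutes_sign[OF j] det_form_permute[of "{1..n + 2}" "to_second j" f v]
    by simp
  ultimately show ?thesis by (simp add: add.commute)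
qed

text \<open>The induction generalizes over \<open>\<kappa>\<close> and \<open>f\<close>, since every
  submatrix in the expansion carries renumbered ones.\<close>

lemma Pf_gauss_form:
  "Pf (2 * l) (gauss_form c \<kappa> f) = (\<lambda>v. curvature_poly l c \<kappa> * det_form {1..2 * l} f v)"
proof (induction l arbitrary: \<kappa> f)
  case 0
  show ?case
    by (rule ext) (simp add: Pf.simps curvature_poly_def odd_dfact_def elem_sym_eq_esym esym_0
        det_form_def)
next
  case (Suc l)
  show ?case
  proof
    fix v
    have "Pf (2 * Suc l) (gauss_form c \<kappa> f) v =
        (\<Sum>j = 2..2 * l + 2. (c + \<kappa> 1 * \<kappa> j) * curvature_poly l c (\<lambda>i. \<kappa> (skip j i))) *
        det_form {1..2 * l + 2} f v"
    \<comment> \<open>\<open>Pf\<close> has a separate clause for size 2; there the sum has the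
      single term \<open>j = 2\<close>, with \<open>curvature_poly 0\<close> equal to 1.\<close>
    proof (cases "l = 0")
      case True
      have "det_form {1..2} (\<lambda>i. if i = 1 then f 1 else f 2) = det_form {1..2} f"
        by (rule det_form_cong) (auto simp: le_Suc_eq numeral_2_eq_2)
      moreover have "curvature_poly 0 c \<mu> = 1" for \<mu>
        by (simp add: curvature_poly_def odd_dfact_def elem_sym_eq_esym esym_0)
      ultimately show ?thesis
        using True wedge_one_form_one_form[of "f 1" "f 2"]
        by (simp add: Pf.simps[of 2] gauss_form_def) (simp add: numeral_2_eq_2)
    next
      case False
      then have "Pf (2 * Suc l) (gauss_form c \<kappa> f) v = (\<Sum>j = 2..2 * l + 2. (-1) ^ j *
          wedge 2 (2 * l) (gauss_form c \<kappa> f 1 j) (Pf (2 * l) (remove_1 j (gauss_form c \<kappa> f))) v)"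
        by (subst Pf.simps) simp
      also have "\<dots> = (\<Sum>j = 2..2 * l + 2. (c + \<kappa> 1 * \<kappa> j) *
          curvature_poly l c (\<lambda>i. \<kappa> (skip j i)) * det_form {1..2 * l + 2} f v)"
      proof (intro sum.cong refl)
        fix j assume "j \<in> {2..2 * l + 2}"
        then have j: "2 \<le> j" "j \<le> 2 * l + 2" by auto
        \<comment> \<open>One sign comes from the row expansion, the other from moving
          \<open>f j\<close> to second place.\<close>
        have "((-1) ^ j * (-1) ^ j :: real) = 1"
          by (simp flip: power_mult_distrib)
        then show "(-1) ^ j * wedge 2 (2 * l) (gauss_form c \<kappa> f 1 j)
            (Pf (2 * l) (remove_1 j (gauss_form c \<kappa> f))) v =
            (c + \<kappa> 1 * \<kappa> j) * curvature_poly l c (\<lambda>i. \<kappa> (skip j i)) *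
            det_form {1..2 * l + 2} f v"
          unfolding remove_1_gauss_form Suc.IH gauss_form_def wedge_scale
            wedge_det_form_to_second[OF j]
          by (simp add: mult_ac)
      qed
      finally show ?thesis by (simp only: sum_distrib_right)
    qed
    then show "Pf (2 * Suc l) (gauss_form c \<kappa> f) v =
        curvature_poly (Suc l) c \<kappa> * det_form {1..2 * Suc l} f v"
      by (simp only: curvature_poly_recursion) simp
  qed
qed

theorem proposition4p5:
  fixes \<A> :: "('p::{t2_space, second_countable_topology}, 'm::finite) chart set"
    and g :: "('p, 'm) metric"
    and \<nu> :: "('p, 'm) chart \<Rightarrow> real^'m \<Rightarrow> real^'m"
    and b :: "'m \<Rightarrow> nat" and M :: "'p set"
    and l n :: nat and c :: real
    and C :: "('p, 'm) chart" and p :: 'p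
    and e :: "nat \<Rightarrow> real^'m" and \<kappa> :: "nat \<Rightarrow> real"
  assumes "n = 2 * l" and "CARD('m) = n + 1"
    and "bij_betw b UNIV {0..n}"
    and "oriented_smooth_atlas \<A>"
    and "riemannian_metric \<A> g"
    and "constant_sectional_curvature \<A> g c"
    and "hypersurface \<A> M"
    and "unit_normal_field \<A> g M \<nu>"
    and "C \<in> \<A>" and "p \<in> M" and "p \<in> cdom C"
    and "principal_frame b g M \<nu> C (cmap C p) n e \<kappa>"
  shows "\<forall>v. (\<forall>i\<in>{1..n}. v i \<in> tangent_space (local_image M C) (cmap C p)) \<longrightarrow>
           Pf n (curvature_form n c \<kappa> e) v = curvature_poly l c \<kappa> * vol_form n e v"
proof -
  \<comment> \<open>The volume form becomes the determinant of the functionals dual to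
    \<open>e\<close>, the same ones that enter the curvature forms.\<close>
  have "vol_form n e = det_form {1..n} (\<lambda>i v. representation (e ` {1..n}) v (e i))"
    unfolding vol_form_def wedge_upto_one_form[symmetric] by (simp add: coframe_def[abs_def])
  then show ?thesis
    by (simp add: curvature_form_eq_gauss_form \<open>n = 2 * l\<close> Pf_gauss_form)
qed

end
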